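(* Let $\{e_1,\dots,e_4,\bar e_1,\dots,\bar e_4,\tilde e_1,\dots,\tilde e_4,f_1,f_2\}$ be a basis for a $14$-dimensional real vector space $V$. Define an inner product $\langle\cdot,\cdot\rangle$ and an algebraic curvature tensor $A$ on $V$ whose non-zero components relative to this basis are, up to the usual symmetries, given by $$\langle e_1,e_2\rangle=\langle e_3,e_4\rangle=\langle\bar e_1,\bar e_2\rangle=\langle\bar e_3,\bar e_4\rangle=\langle\tilde e_1,\tilde e_2\rangle=\langle\tilde e_3,\tilde e_4\rangle=1,$$ $$\langle f_1,f_1\rangle=\langle f_2,f_2\rangle=-\tfrac12,\qquad\langle f_1,f_2\rangle=\tfrac14,$$ $$A(e_1,\tilde e_1,\tilde e_1,e_3)=A(e_1,\bar e_1,\bar e_1,e_4)=1,\qquad A(\bar e_1,e_1,e_1,\bar e_3)=A(\bar e_1,\tilde e_1,\tilde e_1,\bar e_4)=1,$$ $$A(\tilde e_1,e_1,e_1,\tilde e_3)=A(\tilde e_1,\bar e_1,\bar e_1,\tilde e_4)=1,$$ $$A(e_1,\bar e_1,\tilde e_1,f_1)=A(e_1,\tilde e_1,\bar e_1,f_1)=A(\bar e_1,\tilde e_1,e_1,f_2)=A(\bar e_1,e_1,\tilde e_1,f_2)=-\tfrac12.$$ Then $\mathfrak{M}:=(V,\langle\cdot,\cdot\rangle,A)$ is Jacobi--Tsankov, $\mathfrak{M}$ has signature $(8,6)$, and $\mathfrak{M}$ is not $2$-step Jacobi nilpotent.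
   Context: An algebraic curvature tensor on $V$ is $A\in\otimes^4V^*$ with $A(x,y,z,w)=-A(y,x,z,w)=A(z,w,x,y)$ and $A(x,y,z,w)+A(y,z,x,w)+A(z,x,y,w)=0$ for all $x,y,z,w\in V$. "Up to the usual symmetries" means that all components obtained from the listed ones by $\langle x,y\rangle=\langle y,x\rangle$ and by $A(x,y,z,w)=-A(y,x,z,w)=A(z,w,x,y)$ are included, and all remaining components vanish. Signature $(p,q)$ means $p$ negative and $q$ positive directions. The curvature operator $\mathcal{A}(x,y)\in\operatorname{End}(V)$ is defined by $\langle\mathcal{A}(x,y)z,w\rangle=A(x,y,z,w)$, and the Jacobi operator is $\mathcal{J}(x):y\mapsto\mathcal{A}(y,x)x$. $\mathfrak{M}$ is Jacobi--Tsankov if $\mathcal{J}(x)\mathcal{J}(y)=\mathcal{J}(y)\mathcal{J}(x)$ for all $x,y\in V$, and $2$-step Jacobi nilpotent if $\mathcal{J}(x)\mathcal{J}(y)=0$ for all $x,y\in V$. *)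

theory Defs
  imports "HOL-Analysis.Analysis"
begin

text \<open>Inner products are pseudo-Riemannian: symmetric and non-degenerate, of arbitrary signature.\<close>

definition inner_product_form :: "('v::real_vector \<Rightarrow> 'v \<Rightarrow> real) \<Rightarrow> bool" where
  "inner_product_form g \<longleftrightarrow>
     bilinear g \<and> (\<forall>x y. g x y = g y x) \<and> (\<forall>x. (\<forall>y. g x y = 0) \<longrightarrow> x = 0)"

definition quadrilinear :: "('v::real_vector \<Rightarrow> 'v \<Rightarrow> 'v \<Rightarrow> 'v \<Rightarrow> real) \<Rightarrow> bool" where
  "quadrilinear A \<longleftrightarrow>
     (\<forall>y z w. linear (\<lambda>x. A x y z w)) \<and> (\<forall>x z w. linear (\<lambda>y. A x y z w)) \<and>
     (\<forall>x y w. linear (\<lambda>z. A x y z w)) \<and> (\<forall>x y z. linear (\<lambda>w. A x y z w))"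

definition algebraic_curvature_tensor :: "('v::real_vector \<Rightarrow> 'v \<Rightarrow> 'v \<Rightarrow> 'v \<Rightarrow> real) \<Rightarrow> bool" where
  "algebraic_curvature_tensor A \<longleftrightarrow>
     quadrilinear A \<and>
     (\<forall>x y z w. A x y z w = - A y x z w) \<and>
     (\<forall>x y z w. A x y z w = A z w x y) \<and>
     (\<forall>x y z w. A x y z w + A y z x w + A z x y w = 0)"

text \<open>The description below determines a unique vector when \<open>g\<close> is an inner product and
  \<open>A\<close> is quadrilinear on a finite-dimensional space.\<close>

definition curvature_operator ::
  "('v::real_vector \<Rightarrow> 'v \<Rightarrow> real) \<Rightarrow> ('v \<Rightarrow> 'v \<Rightarrow> 'v \<Rightarrow> 'v \<Rightarrow> real) \<Rightarrow> 'v \<Rightarrow> 'v \<Rightarrow> 'v \<Rightarrow> 'v" where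
  "curvature_operator g A x y z = (THE u. \<forall>w. g u w = A x y z w)"

definition jacobi_operator ::
  "('v::real_vector \<Rightarrow> 'v \<Rightarrow> real) \<Rightarrow> ('v \<Rightarrow> 'v \<Rightarrow> 'v \<Rightarrow> 'v \<Rightarrow> real) \<Rightarrow> 'v \<Rightarrow> 'v \<Rightarrow> 'v" where
  "jacobi_operator g A x = (\<lambda>y. curvature_operator g A y x x)"

definition jacobi_tsankov ::
  "('v::real_vector \<Rightarrow> 'v \<Rightarrow> real) \<Rightarrow> ('v \<Rightarrow> 'v \<Rightarrow> 'v \<Rightarrow> 'v \<Rightarrow> real) \<Rightarrow> bool" where
  "jacobi_tsankov g A \<longleftrightarrow>
     (\<forall>x y. jacobi_operator g A x \<circ> jacobi_operator g A y
          = jacobi_operator g A y \<circ> jacobi_operator g A x)"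

definition two_step_jacobi_nilpotent ::
  "('v::real_vector \<Rightarrow> 'v \<Rightarrow> real) \<Rightarrow> ('v \<Rightarrow> 'v \<Rightarrow> 'v \<Rightarrow> 'v \<Rightarrow> real) \<Rightarrow> bool" where
  "two_step_jacobi_nilpotent g A \<longleftrightarrow>
     (\<forall>x y. jacobi_operator g A x \<circ> jacobi_operator g A y = (\<lambda>_. 0))"

text \<open>Signature \<open>(p, q)\<close>: some orthonormal basis consists of \<open>p\<close> vectors of square \<open>-1\<close>
  and \<open>q\<close> vectors of square \<open>1\<close>.\<close>

definition has_signature :: "('v::real_vector \<Rightarrow> 'v \<Rightarrow> real) \<Rightarrow> nat \<Rightarrow> nat \<Rightarrow> bool" where
  "has_signature g p q \<longleftrightarrow>
     (\<exists>N P. finite N \<and> finite P \<and> N \<inter> P = {} \<and> card N = p \<and> card P = q \<and>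
        independent (N \<union> P) \<and> span (N \<union> P) = UNIV \<and>
        (\<forall>x\<in>N. g x x = -1) \<and> (\<forall>x\<in>P. g x x = 1) \<and>
        (\<forall>x\<in>N \<union> P. \<forall>y\<in>N \<union> P. x \<noteq> y \<longrightarrow> g x y = 0))"

text \<open>Labels of the basis vectors: \<open>E\<close>, \<open>EB\<close>, \<open>ET\<close> stand for the unmarked, barred and
  tilded \<open>e\<close>'s.\<close>

datatype label = E1 | E2 | E3 | E4 | EB1 | EB2 | EB3 | EB4 | ET1 | ET2 | ET3 | ET4 | F1 | F2

inductive metric_component :: "label \<Rightarrow> label \<Rightarrow> real \<Rightarrow> bool" where
  "metric_component E1 E2 1"
| "metric_component E3 E4 1"
| "metric_component EB1 EB2 1"
| "metric_component EB3 EB4 1"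
| "metric_component ET1 ET2 1"
| "metric_component ET3 ET4 1"
| "metric_component F1 F1 (- 1 / 2)"
| "metric_component F2 F2 (- 1 / 2)"
| "metric_component F1 F2 (1 / 4)"
| "metric_component i j c \<Longrightarrow> metric_component j i c"

inductive curvature_component :: "label \<Rightarrow> label \<Rightarrow> label \<Rightarrow> label \<Rightarrow> real \<Rightarrow> bool" where
  "curvature_component E1 ET1 ET1 E3 1"
| "curvature_component E1 EB1 EB1 E4 1"
| "curvature_component EB1 E1 E1 EB3 1"
| "curvature_component EB1 ET1 ET1 EB4 1"
| "curvature_component ET1 E1 E1 ET3 1"
| "curvature_component ET1 EB1 EB1 ET4 1"
| "curvature_component E1 EB1 ET1 F1 (- 1 / 2)"
| "curvature_component E1 ET1 EB1 F1 (- 1 / 2)"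
| "curvature_component EB1 ET1 E1 F2 (- 1 / 2)"
| "curvature_component EB1 E1 ET1 F2 (- 1 / 2)"
| "curvature_component i j k l c \<Longrightarrow> curvature_component j i k l (- c)"
| "curvature_component i j k l c \<Longrightarrow> curvature_component k l i j c"

definition metric_components_on ::
  "(label \<Rightarrow> 'v::real_vector) \<Rightarrow> ('v \<Rightarrow> 'v \<Rightarrow> real) \<Rightarrow> bool" where
  "metric_components_on b g \<longleftrightarrow>
     (\<forall>i j c. metric_component i j c \<longrightarrow> g (b i) (b j) = c) \<and>
     (\<forall>i j. (\<nexists>c. metric_component i j c) \<longrightarrow> g (b i) (b j) = 0)"

definition curvature_components_on ::
  "(label \<Rightarrow> 'v::real_vector) \<Rightarrow> ('v \<Rightarrow> 'v \<Rightarrow> 'v \<Rightarrow> 'v \<Rightarrow> real) \<Rightarrow> bool" where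
  "curvature_components_on b A \<longleftrightarrow>
     (\<forall>i j k l c. curvature_component i j k l c \<longrightarrow> A (b i) (b j) (b k) (b l) = c) \<and>
     (\<forall>i j k l. (\<nexists>c. curvature_component i j k l c) \<longrightarrow> A (b i) (b j) (b k) (b l) = 0)"

end

theory Submission
  imports Defs
begin

text \<open>
  In coordinates with respect to \<open>b\<close>, the metric is a sum of symmetric products and the tensor
  \<open>A\<close> is a sum of symmetric products of \<open>2\<close>-forms, so that all symmetries except the Bianchi
  identity are automatic. Since \<open>g (J x (J y z)) w = g (J y z) (J x w)\<close> by self-adjointness of
  the Jacobi operators, the Jacobi--Tsankov property is the symmetry of this expression in \<open>x\<close>
  and \<open>y\<close>, a polynomial identity: Jacobi operators take values in the span of all basis vectors
  except \<open>E1\<close>, \<open>EB1\<close>, \<open>ET1\<close>, so only the \<open>E3\<close>/\<open>E4\<close> planes and the \<open>F\<close> plane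
  contribute.
\<close>

section \<open>Multilinear extension, curvature operators and independence\<close>

lemma UNIV_label:
  "(UNIV :: label set) = {E1, E2, E3, E4, EB1, EB2, EB3, EB4, ET1, ET2, ET3, ET4, F1, F2}"
  by (auto intro: label.exhaust)

lemma finite_label: "finite (UNIV :: label set)"
  by (simp add: UNIV_label)

lemma quadrilinear_eqI:
  assumes "quadrilinear A" "quadrilinear B" and span: "span S = UNIV"
    and eq: "\<And>x y z w. x \<in> S \<Longrightarrow> y \<in> S \<Longrightarrow> z \<in> S \<Longrightarrow> w \<in> S \<Longrightarrow> A x y z w = B x y z w"
  shows "A = B"
proof -
  note lin = assms(1,2)[unfolded quadrilinear_def]
  have 1: "A x y z w = B x y z w" if "x \<in> S" "y \<in> S" "z \<in> S" for x y z w
    by (rule linear_eq_on_span[of "\<lambda>w. A x y z w" "\<lambda>w. B x y z w" S]) (use lin eq that span in auto)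
  have 2: "A x y z w = B x y z w" if "x \<in> S" "y \<in> S" for x y z w
    by (rule linear_eq_on_span[of "\<lambda>z. A x y z w" "\<lambda>z. B x y z w" S]) (use lin 1 that span in auto)
  have 3: "A x y z w = B x y z w" if "x \<in> S" for x y z w
    by (rule linear_eq_on_span[of "\<lambda>y. A x y z w" "\<lambda>y. B x y z w" S]) (use lin 2 that span in auto)
  have "A x y z w = B x y z w" for x y z w
    by (rule linear_eq_on_span[of "\<lambda>x. A x y z w" "\<lambda>x. B x y z w" S]) (use lin 3 span in auto)
  then show ?thesis
    by blast
qed

text \<open>Pair symmetry combined with skewness in both pairs. For \<open>y = z\<close> this is the
  self-adjointness of the Jacobi operator of that vector.\<close>

lemma algebraic_curvature_tensor_rev:
  assumes "algebraic_curvature_tensor A"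
  shows "A x y z w = A w z y x"
  using assms unfolding algebraic_curvature_tensor_def by (metis minus_minus)

text \<open>Non-degeneracy makes the representing vector unique, so any explicit candidate resolves
  the definite description.\<close>

lemma curvature_operator_eqI:
  assumes g: "inner_product_form g" and u: "\<And>w. g u w = A x y z w"
  shows "curvature_operator g A x y z = u"
  unfolding curvature_operator_def
proof (rule the_equality)
  fix v assume v: "\<forall>w. g v w = A x y z w"
  have "g (v - u) w = 0" for w
    using g u v by (metis inner_product_form_def bilinear_lsub diff_self)
  then have "v - u = 0"
    using g unfolding inner_product_form_def by blast
  then show "v = u" by simp
qed (use u in blast)

text \<open>Pairing a linear relation with \<open>v i\<close> isolates \<open>c i * s i\<close>. The
  family is indexed so that injectivity, used later for counting, comes with independence.\<close>

lemma orthogonal_independent: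
  fixes g :: "'v::real_vector \<Rightarrow> 'v \<Rightarrow> real"
  assumes g: "bilinear g" and "finite I"
    and orth: "\<And>i j. i \<in> I \<Longrightarrow> j \<in> I \<Longrightarrow> g (v i) (v j) = (if i = j then s i else 0)"
    and nz: "\<And>i. i \<in> I \<Longrightarrow> s i \<noteq> 0"
  shows "inj_on v I" "independent (v ` I)"
proof -
  show inj: "inj_on v I"
    using orth nz by (intro inj_onI) metis
  have "c i = 0" if 0: "(\<Sum>j\<in>I. c j *\<^sub>R v j) = 0" and i: "i \<in> I" for c i
  proof -
    have "0 = g (\<Sum>j\<in>I. c j *\<^sub>R v j) (v i)"
      using g 0 by (simp add: bilinear_lzero)
    also have "\<dots> = (\<Sum>j\<in>I. c j * g (v j) (v i))"
    proof -
      have lin: "linear (\<lambda>x. g x (v i))"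
        using g by (simp add: bilinear_def)
      show ?thesis
        by (simp add: linear_sum[OF lin] linear_scale[OF lin])
    qed
    also have "\<dots> = (\<Sum>j\<in>I. if j = i then c i * s i else 0)"
      by (rule sum.cong) (use orth i in auto)
    also have "\<dots> = c i * s i"
      using \<open>finite I\<close> i by simp
    finally show "c i = 0"
      using nz[OF i] by simp
  qed
  then have "\<forall>c. (\<Sum>x\<in>v ` I. c x *\<^sub>R x) = 0 \<longrightarrow> (\<forall>x\<in>v ` I. c x = 0)"
    by (auto simp: sum.reindex[OF inj])
  then show "independent (v ` I)"
    using \<open>finite I\<close> by (auto simp: dependent_finite)
qed

text \<open>A vector outside \<open>span S\<close> could be adjoined to \<open>S\<close>, giving an
  independent set larger than the spanning set \<open>T\<close>.\<close>

lemma independent_card_ge_spans: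
  fixes S T :: "'v::real_vector set"
  assumes "finite T" "span T = UNIV" "independent S" "card T \<le> card S"
  shows "span S = UNIV"
proof -
  have "T \<subseteq> span S"
  proof (rule subsetI, rule ccontr)
    fix t assume "t \<notin> span S"
    then have "independent (insert t S)" "t \<notin> S"
      using assms(3) by (auto simp: independent_insert span_base)
    moreover have "finite S"
      using independent_span_bound[of T S] assms by simp
    ultimately show False
      using independent_span_bound[of T "insert t S"] assms by simp
  qed
  then show ?thesis
    using assms(2) by (metis span_minimal subspace_span top.extremum_uniqueI)
qed

section \<open>Coordinates with respect to the basis\<close>

locale label_basis =
  fixes b :: "label \<Rightarrow> 'v::real_vector"
  assumes inj: "inj b" and indep: "independent (range b)" and span: "span (range b) = UNIV"
begin

definition coord :: "label \<Rightarrow> 'v \<Rightarrow> real" where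
  "coord i x = representation (range b) x (b i)"

lemma linear_coord: "linear (coord i)"
  by (rule linearI)
    (simp_all add: coord_def representation_add representation_scale indep span)

lemmas coord_simps [simp] =
  linear_add[OF linear_coord] linear_diff[OF linear_coord] linear_scale[OF linear_coord]
  linear_0[OF linear_coord]

lemma coord_basis [simp]: "coord i (b j) = (if i = j then 1 else 0)"
  using inj by (auto simp: coord_def representation_basis[OF indep] inj_eq)

lemma coord_eqI:
  assumes "\<And>i. coord i x = coord i y"
  shows "x = y"
proof -
  have "(\<Sum>v | representation (range b) x v \<noteq> 0. representation (range b) x v *\<^sub>R v) = x" for x
    by (rule sum_nonzero_representation_eq) (use indep span in auto)
  moreover have "representation (range b) x = representation (range b) y"
  proof
    fix v show "representation (range b) x v = representation (range b) y v"
    proof (cases "v \<in> range b")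
      case True
      then show ?thesis using assms by (auto simp: coord_def)
    next
      case False
      then show ?thesis by (metis representation_ne_zero)
    qed
  qed
  ultimately show ?thesis by metis
qed

section \<open>The metric and the curvature tensor in coordinates\<close>

definition sym_prod :: "label \<Rightarrow> label \<Rightarrow> 'v \<Rightarrow> 'v \<Rightarrow> real" where
  "sym_prod i j x y = coord i x * coord j y + coord j x * coord i y"

text \<open>Since \<open>sym_prod i i\<close> is twice a product of coordinates, the diagonal value
  -1/2 becomes the coefficient -1/4.\<close>

definition metric :: "'v \<Rightarrow> 'v \<Rightarrow> real" where
  "metric x y = sym_prod E1 E2 x y + sym_prod E3 E4 x y + sym_prod EB1 EB2 x y
     + sym_prod EB3 EB4 x y + sym_prod ET1 ET2 x y + sym_prod ET3 ET4 x y
     - sym_prod F1 F1 x y / 4 - sym_prod F2 F2 x y / 4 + sym_prod F1 F2 x y / 4"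

definition wedge :: "label \<Rightarrow> label \<Rightarrow> 'v \<Rightarrow> 'v \<Rightarrow> real" where
  "wedge i j x y = coord i x * coord j y - coord j x * coord i y"

definition wedge_prod :: "label \<Rightarrow> label \<Rightarrow> label \<Rightarrow> label \<Rightarrow> 'v \<Rightarrow> 'v \<Rightarrow> 'v \<Rightarrow> 'v \<Rightarrow> real" where
  "wedge_prod i j k l x y z w = wedge i j x y * wedge k l z w + wedge k l x y * wedge i j z w"

text \<open>One \<open>wedge_prod\<close> per listed component. Its two label pairs always differ as
  sets, so it takes the value 1 at its own labels.\<close>

definition curv :: "'v \<Rightarrow> 'v \<Rightarrow> 'v \<Rightarrow> 'v \<Rightarrow> real" where
  "curv x y z w = wedge_prod E1 ET1 ET1 E3 x y z w + wedge_prod E1 EB1 EB1 E4 x y z w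
     + wedge_prod EB1 E1 E1 EB3 x y z w + wedge_prod EB1 ET1 ET1 EB4 x y z w
     + wedge_prod ET1 E1 E1 ET3 x y z w + wedge_prod ET1 EB1 EB1 ET4 x y z w
     - (wedge_prod E1 EB1 ET1 F1 x y z w + wedge_prod E1 ET1 EB1 F1 x y z w
        + wedge_prod EB1 ET1 E1 F2 x y z w + wedge_prod EB1 E1 ET1 F2 x y z w) / 2"

lemma metric_sym: "metric x y = metric y x"
  by (simp add: metric_def sym_prod_def algebra_simps)

lemma bilinear_metric: "bilinear metric"
  unfolding bilinear_def
  by (intro conjI allI linearI)
    (simp_all add: metric_def sym_prod_def algebra_simps add_divide_distrib)

text \<open>The vector representing a linear functional, by inverting the Gram matrix.\<close>

definition dual :: "('v \<Rightarrow> real) \<Rightarrow> 'v" where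
  "dual f = f (b E2) *\<^sub>R b E1 + f (b E1) *\<^sub>R b E2 + f (b E4) *\<^sub>R b E3 + f (b E3) *\<^sub>R b E4
     + f (b EB2) *\<^sub>R b EB1 + f (b EB1) *\<^sub>R b EB2 + f (b EB4) *\<^sub>R b EB3 + f (b EB3) *\<^sub>R b EB4
     + f (b ET2) *\<^sub>R b ET1 + f (b ET1) *\<^sub>R b ET2 + f (b ET4) *\<^sub>R b ET3 + f (b ET3) *\<^sub>R b ET4
     - ((8 * f (b F1) + 4 * f (b F2)) / 3) *\<^sub>R b F1
     - ((4 * f (b F1) + 8 * f (b F2)) / 3) *\<^sub>R b F2"

text \<open>Checked on the basis. The Gram matrix of the \<open>F\<close> plane has determinant 3/16
  and inverse with rows (-8/3, -4/3) and (-4/3, -8/3), whence the last two coefficients of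
  \<open>dual\<close>.\<close>

lemma metric_dual:
  assumes "linear f"
  shows "metric (dual f) w = f w"
proof (rule linear_eq_on_span[of _ _ "range b"])
  show "linear (metric (dual f))"
    using bilinear_metric by (simp add: bilinear_def)
  show "metric (dual f) x = f x" if "x \<in> range b" for x
  proof -
    obtain i where "x = b i" using \<open>x \<in> range b\<close> by blast
    then show ?thesis
      by (cases i) (simp_all add: dual_def metric_def sym_prod_def field_simps)
  qed
qed (use assms span in auto)

text \<open>A vector is recovered from its functional; this yields non-degeneracy, and later turns
  equality of functionals into equality of vectors.\<close>

lemma dual_metric: "dual (metric x) = x"
proof (rule coord_eqI)
  fix i
  show "coord i (dual (metric x)) = coord i x"
    by (cases i) (simp_all add: dual_def metric_def sym_prod_def field_simps)
qed

lemma inner_product_form_metric: "inner_product_form metric"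
  unfolding inner_product_form_def
proof (intro conjI allI impI)
  fix x assume "\<forall>y. metric x y = 0"
  then have "dual (metric x) = dual (metric 0)"
    by (simp add: dual_def bilinear_lzero[OF bilinear_metric])
  then show "x = 0"
    by (simp add: dual_metric)
qed (rule bilinear_metric metric_sym)+

lemma metric_components_metric: "metric_components_on b metric"
  unfolding metric_components_on_def
proof (intro conjI allI impI)
  fix i j c assume "metric_component i j c"
  then show "metric (b i) (b j) = c"
  proof induction
    case (10 i j c)
    then show ?case by (simp add: metric_sym)
  qed (simp_all add: metric_def sym_prod_def)
next
  fix i j assume none: "\<nexists>c. metric_component i j c"
  \<comment> \<open>Every summand of \<open>metric\<close> is indexed by a metric component and is
    non-zero only at its own label pair or the swapped one, which is again a component.\<close>
  have zero: "sym_prod p q (b i) (b j) = 0" if "metric_component p q c" for p q c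
    using none that metric_component.intros(10)[OF that] by (auto simp: sym_prod_def)
  then show "metric (b i) (b j) = 0"
    unfolding metric_def by (simp add: metric_component.intros(1-9)[THEN zero])
qed

lemma quadrilinear_curv: "quadrilinear curv"
  unfolding quadrilinear_def
  by (intro conjI allI linearI)
    (simp_all add: curv_def wedge_prod_def wedge_def algebra_simps add_divide_distrib diff_divide_distrib)

lemma curv_skew: "curv x y z w = - curv y x z w"
proof -
  have "wedge i j x y = - wedge i j y x" for i j
    by (simp add: wedge_def)
  then show ?thesis
    by (simp add: curv_def wedge_prod_def field_simps)
qed

lemma curv_pair: "curv x y z w = curv z w x y"
  by (simp add: curv_def wedge_prod_def mult.commute add.commute)

text \<open>The cyclic sum of a symmetric product of two 2-forms is a multiple of their wedge
  product. This vanishes when a label repeats; the two \<open>F1\<close> terms differ by a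
  transposition of labels and cancel, as do the two \<open>F2\<close> terms.\<close>

lemma curv_bianchi: "curv x y z w + curv y z x w + curv z x y w = 0"
  by (simp add: curv_def wedge_prod_def wedge_def field_simps)

lemma algebraic_curvature_tensor_curv: "algebraic_curvature_tensor curv"
  unfolding algebraic_curvature_tensor_def
  using quadrilinear_curv curv_skew curv_pair curv_bianchi by blast

lemma curvature_components_curv: "curvature_components_on b curv"
  unfolding curvature_components_on_def
proof (intro conjI allI impI)
  fix i j k l c assume "curvature_component i j k l c"
  then show "curv (b i) (b j) (b k) (b l) = c"
  proof induction
    case (11 i j k l c)
    then show ?case using curv_skew by metis
  next
    case (12 i j k l c)
    then show ?case using curv_pair by metis
  qed (simp_all add: curv_def wedge_prod_def wedge_def)
next
  fix i j k l assume none: "\<nexists>c. curvature_component i j k l c"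
  \<comment> \<open>A non-zero value forces \<open>i, j\<close> and \<open>k, l\<close> to agree
    with \<open>p, q\<close> and \<open>r, s\<close> up to order, so the symmetry rules would make
    \<open>i j k l\<close> a component.\<close>
  have wedge_zero: "wedge p q (b i) (b j) * wedge r s (b k) (b l) = 0"
    if "curvature_component p q r s c" for p q r s c
  proof (rule ccontr)
    assume "\<not> ?thesis"
    then have "(i, j) \<in> {(p, q), (q, p)}" "(k, l) \<in> {(r, s), (s, r)}"
      by (auto simp: wedge_def split: if_splits)
    then show False
      using none that curvature_component.intros(11,12) by (metis insertE singletonD Pair_inject)
  qed
  have zero: "wedge_prod p q r s (b i) (b j) (b k) (b l) = 0"
    if "curvature_component p q r s c" for p q r s c
    using wedge_zero[OF that] wedge_zero[OF curvature_component.intros(12)[OF that]]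
    unfolding wedge_prod_def by linarith
  then show "curv (b i) (b j) (b k) (b l) = 0"
    unfolding curv_def by (simp add: curvature_component.intros(1-10)[THEN zero])
qed

lemma metric_unique:
  assumes "inner_product_form g" "metric_components_on b g"
  shows "g = metric"
proof -
  have eq: "g (b i) (b j) = metric (b i) (b j)" for i j
    using assms(2) metric_components_metric unfolding metric_components_on_def by metis
  have "g x y = metric x y" for x y
    by (rule bilinear_eq[of g metric UNIV "range b" UNIV "range b"])
      (use assms(1) bilinear_metric span eq in \<open>auto simp: inner_product_form_def\<close>)
  then show ?thesis by blast
qed

text \<open>The components prescribe every value on basis vectors, zero included, and
  quadrilinearity does the rest.\<close>

lemma curv_unique:
  assumes "algebraic_curvature_tensor A" "curvature_components_on b A"
  shows "A = curv"
proof (rule quadrilinear_eqI[OF _ quadrilinear_curv span])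
  have "A (b i) (b j) (b k) (b l) = curv (b i) (b j) (b k) (b l)" for i j k l
    using assms(2) curvature_components_curv unfolding curvature_components_on_def by metis
  then show "A x y z w = curv x y z w"
    if "x \<in> range b" "y \<in> range b" "z \<in> range b" "w \<in> range b" for x y z w
    using that by blast
qed (use assms(1) in \<open>simp add: algebraic_curvature_tensor_def\<close>)

section \<open>Jacobi operators: commutation and a non-zero product\<close>

abbreviation jacobi :: "'v \<Rightarrow> 'v \<Rightarrow> 'v" where
  "jacobi \<equiv> jacobi_operator metric curv"

lemma jacobi_eq: "jacobi x y = dual (curv y x x)"
  unfolding jacobi_operator_def
  by (rule curvature_operator_eqI[OF inner_product_form_metric], rule metric_dual)
    (use quadrilinear_curv in \<open>simp add: quadrilinear_def\<close>)

lemma metric_jacobi: "metric (jacobi x y) w = curv y x x w"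
  unfolding jacobi_eq
  by (rule metric_dual) (use quadrilinear_curv in \<open>simp add: quadrilinear_def\<close>)

lemma metric_jacobi_jacobi: "metric (jacobi x (jacobi y z)) w = metric (jacobi y z) (jacobi x w)"
  by (metis metric_jacobi metric_sym algebraic_curvature_tensor_rev
      algebraic_curvature_tensor_curv)

text \<open>The \<open>E1\<close>, \<open>EB1\<close>, \<open>ET1\<close> coordinates of Jacobi
  values vanish because \<open>curv\<close> kills \<open>b E2\<close>, \<open>b EB2\<close>,
  \<open>b ET2\<close>. What remains is a polynomial identity in the \<open>E1\<close>,
  \<open>EB1\<close>, \<open>ET1\<close> coordinates of the four vectors.\<close>

lemma metric_jacobi_commute:
  "metric (jacobi y z) (jacobi x w) = metric (jacobi x z) (jacobi y w)"
  by (simp add: jacobi_eq dual_def metric_def sym_prod_def curv_def wedge_prod_def wedge_def)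
    algebra

lemma jacobi_tsankov: "jacobi_tsankov metric curv"
  unfolding jacobi_tsankov_def
proof (intro allI ext)
  fix x y z
  have "metric (jacobi x (jacobi y z)) = metric (jacobi y (jacobi x z))"
    by (simp add: fun_eq_iff metric_jacobi_jacobi metric_jacobi_commute)
  then show "(jacobi x \<circ> jacobi y) z = (jacobi y \<circ> jacobi x) z"
    by (metis comp_apply dual_metric)
qed

lemma not_two_step_jacobi_nilpotent: "\<not> two_step_jacobi_nilpotent metric curv"
proof
  assume "two_step_jacobi_nilpotent metric curv"
  \<comment> \<open>Here \<open>jacobi (b ET1) (b E1)\<close> is \<open>b E4\<close> and
    \<open>jacobi (b EB1) (b E1)\<close> is \<open>b E3\<close>, whose product is 1.\<close>
  then have "jacobi (b EB1) (jacobi (b ET1) (b E1)) = 0"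
    unfolding two_step_jacobi_nilpotent_def by (metis comp_apply)
  then have "metric (jacobi (b ET1) (b E1)) (jacobi (b EB1) (b E1)) = 0"
    by (metis metric_jacobi_jacobi bilinear_lzero bilinear_metric)
  then show False
    by (simp add: jacobi_eq dual_def metric_def sym_prod_def curv_def wedge_prod_def wedge_def)
qed

section \<open>Signature\<close>

text \<open>Each of the six hyperbolic planes contributes one vector of either sign. In the negative
  definite \<open>F\<close> plane, \<open>b F1 + b F2\<close> and \<open>b F1 - b F2\<close> are
  orthogonal with squares -1/2 and -3/2, hence the scalings.\<close>

primrec frame :: "label \<Rightarrow> 'v" where
  "frame E1 = b E1 + (1 / 2) *\<^sub>R b E2"
| "frame E2 = b E1 - (1 / 2) *\<^sub>R b E2"
| "frame E3 = b E3 + (1 / 2) *\<^sub>R b E4"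
| "frame E4 = b E3 - (1 / 2) *\<^sub>R b E4"
| "frame EB1 = b EB1 + (1 / 2) *\<^sub>R b EB2"
| "frame EB2 = b EB1 - (1 / 2) *\<^sub>R b EB2"
| "frame EB3 = b EB3 + (1 / 2) *\<^sub>R b EB4"
| "frame EB4 = b EB3 - (1 / 2) *\<^sub>R b EB4"
| "frame ET1 = b ET1 + (1 / 2) *\<^sub>R b ET2"
| "frame ET2 = b ET1 - (1 / 2) *\<^sub>R b ET2"
| "frame ET3 = b ET3 + (1 / 2) *\<^sub>R b ET4"
| "frame ET4 = b ET3 - (1 / 2) *\<^sub>R b ET4"
| "frame F1 = sqrt 2 *\<^sub>R (b F1 + b F2)"
| "frame F2 = sqrt (2 / 3) *\<^sub>R (b F1 - b F2)"

definition pos :: "label set" where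
  "pos = {E1, E3, EB1, EB3, ET1, ET3}"

definition neg :: "label set" where
  "neg = {E2, E4, EB2, EB4, ET2, ET4, F1, F2}"

lemma metric_frame:
  "metric (frame i) (frame j) = (if i = j then if i \<in> neg then -1 else 1 else 0)"
proof -
  have "sqrt (2 / 3) * sqrt (2 / 3) = 2 / (3 :: real)"
    by simp
  then show ?thesis
    by (cases i; cases j)
      (simp_all add: metric_def sym_prod_def neg_def algebra_simps)
qed

lemma has_signature_metric: "has_signature metric 8 6"
proof -
  have inj_frame: "inj frame" and indep_frame: "independent (range frame)"
    using orthogonal_independent[OF bilinear_metric finite_label, of frame, OF metric_frame] by auto
  \<comment> \<open>By counting: both families are injective images of the label type.\<close>
  have "span (range frame) = UNIV"
    using independent_card_ge_spans[of "range b" "range frame"] finite_label span indep_frame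
    by (simp add: card_image inj inj_frame)
  moreover have "frame ` neg \<union> frame ` pos = range frame"
    unfolding image_Un[symmetric]
    by (rule arg_cong[of _ _ "image frame"]) (auto simp: UNIV_label neg_def pos_def)
  moreover have "neg \<inter> pos = {}"
    by (simp add: neg_def pos_def)
  moreover from this have "frame ` neg \<inter> frame ` pos = {}"
    unfolding image_Int[OF inj_frame, symmetric] by simp
  moreover have "card (frame ` neg) = card neg" "card (frame ` pos) = card pos"
    using inj_frame by (auto intro: card_image inj_on_subset)
  moreover have "card neg = 8" "card pos = 6" "finite neg" "finite pos"
    by (simp_all add: neg_def pos_def)
  moreover have "\<forall>x\<in>frame ` neg. metric x x = -1" "\<forall>x\<in>frame ` pos. metric x x = 1"
    using \<open>neg \<inter> pos = {}\<close> by (auto simp: metric_frame)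
  moreover have "\<forall>x\<in>range frame. \<forall>y\<in>range frame. x \<noteq> y \<longrightarrow> metric x y = 0"
    by (auto simp: metric_frame)
  ultimately show ?thesis
    unfolding has_signature_def using indep_frame
    by (intro exI[of _ "frame ` neg"] exI[of _ "frame ` pos"]) simp
qed

end

theorem lemma3p2:
  fixes b :: "label \<Rightarrow> 'v::real_vector"
  assumes "inj b" and "independent (range b)" and "span (range b) = UNIV"
  shows "(\<exists>!g. inner_product_form g \<and> metric_components_on b g) \<and>
         (\<exists>!A. algebraic_curvature_tensor A \<and> curvature_components_on b A) \<and>
         (\<forall>g A. inner_product_form g \<and> metric_components_on b g \<and>
                algebraic_curvature_tensor A \<and> curvature_components_on b A \<longrightarrow>
            jacobi_tsankov g A \<and> has_signature g 8 6 \<and> \<not> two_step_jacobi_nilpotent g A)"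
proof -
  interpret label_basis b
    by unfold_locales (use assms in auto)
  show ?thesis
  proof (intro conjI)
    show "\<exists>!g. inner_product_form g \<and> metric_components_on b g"
      using inner_product_form_metric metric_components_metric metric_unique by blast
    show "\<exists>!A. algebraic_curvature_tensor A \<and> curvature_components_on b A"
      using algebraic_curvature_tensor_curv curvature_components_curv curv_unique by blast
    \<comment> \<open>Uniqueness identifies \<open>g\<close> with \<open>metric\<close> and
      \<open>A\<close> with \<open>curv\<close>.\<close>
    show "\<forall>g A. inner_product_form g \<and> metric_components_on b g \<and>
        algebraic_curvature_tensor A \<and> curvature_components_on b A \<longrightarrow>
        jacobi_tsankov g A \<and> has_signature g 8 6 \<and> \<not> two_step_jacobi_nilpotent g A"
      using metric_unique curv_unique jacobi_tsankov has_signature_metric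
        not_two_step_jacobi_nilpotent by blast
  qed
qed

end
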